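(* Let $\Sigma$ be a finite alphabet with $|\Sigma|>1$ and let $n\ge 1$ be an integer. Let $B=\{1,\ldots,n|\Sigma|^{n-1}\}$. Then there exists a $(1,2)$-sensitive bucketing function $f:\mathcal{S}_n\to\mathcal{P}(B)$ with $|f(s)|=n$ for every $s\in\mathcal{S}_n$. Moreover, for any finite set of buckets $B'$, no $(1,2)$-sensitive bucketing function $g:\mathcal{S}_n\to\mathcal{P}(B')$ exists if $|B'|<n|\Sigma|^{n-1}$, and no $(1,2)$-sensitive bucketing function $g$ exists with $|g(s)|<n$ for some $s\in\mathcal{S}_n$.
   Context: $\mathcal{S}_n$ denotes the set $\Sigma^n$ of all sequences of length $n$ over $\Sigma$, equipped with the edit (Levenshtein) distance $\mathrm{edit}(s,t)$, the minimum number of single-character insertions, deletions and substitutions transforming $s$ into $t$. Given a set $B$ of buckets, a bucketing function is a map $f:\mathcal{S}_n\to\mathcal{P}(B)$ (power set of $B$). For non-negative integers $d_1<d_2$, $f$ is $(d_1,d_2)$-sensitive if for all $s,t\in\mathcal{S}_n$: $\mathrm{edit}(s,t)\le d_1$ implies $f(s)\cap f(t)\ne\emptyset$, and $\mathrm{edit}(s,t)\ge d_2$ implies $f(s)\cap f(t)=\emptyset$. *)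

theory Defs
  imports Main
begin

definition seqs :: "'a set \<Rightarrow> nat \<Rightarrow> 'a list set" where
  "seqs \<Sigma> n = {s. set s \<subseteq> \<Sigma> \<and> length s = n}"

text \<open>One single-character operation on sequences of arbitrary length over \<open>\<Sigma>\<close>;
  intermediate sequences of an edit need not have length \<open>n\<close>.\<close>

inductive edit_step :: "'a set \<Rightarrow> 'a list \<Rightarrow> 'a list \<Rightarrow> bool" for \<Sigma> :: "'a set" where
  insertion: "set (u @ v) \<subseteq> \<Sigma> \<Longrightarrow> a \<in> \<Sigma> \<Longrightarrow> edit_step \<Sigma> (u @ v) (u @ a # v)"
| deletion: "set (u @ v) \<subseteq> \<Sigma> \<Longrightarrow> a \<in> \<Sigma> \<Longrightarrow> edit_step \<Sigma> (u @ a # v) (u @ v)"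
| substitution: "set (u @ v) \<subseteq> \<Sigma> \<Longrightarrow> a \<in> \<Sigma> \<Longrightarrow> b \<in> \<Sigma> \<Longrightarrow> a \<noteq> b \<Longrightarrow>
    edit_step \<Sigma> (u @ a # v) (u @ b # v)"

text \<open>The minimum exists for all \<open>s\<close>, \<open>t\<close> over \<open>\<Sigma>\<close>: delete all of \<open>s\<close>, then insert all of \<open>t\<close>.\<close>

definition edit :: "'a set \<Rightarrow> 'a list \<Rightarrow> 'a list \<Rightarrow> nat" where
  "edit \<Sigma> s t = (LEAST k. (edit_step \<Sigma> ^^ k) s t)"

definition bucketing_function ::
    "'a set \<Rightarrow> nat \<Rightarrow> 'b set \<Rightarrow> ('a list \<Rightarrow> 'b set) \<Rightarrow> bool" where
  "bucketing_function \<Sigma> n B f \<longleftrightarrow> (\<forall>s \<in> seqs \<Sigma> n. f s \<in> Pow B)"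

definition sensitive ::
    "'a set \<Rightarrow> nat \<Rightarrow> nat \<Rightarrow> nat \<Rightarrow> ('a list \<Rightarrow> 'b set) \<Rightarrow> bool" where
  "sensitive \<Sigma> n d1 d2 f \<longleftrightarrow>
    (\<forall>s \<in> seqs \<Sigma> n. \<forall>t \<in> seqs \<Sigma> n.
      (edit \<Sigma> s t \<le> d1 \<longrightarrow> f s \<inter> f t \<noteq> {}) \<and>
      (edit \<Sigma> s t \<ge> d2 \<longrightarrow> f s \<inter> f t = {}))"

end

theory Submission
  imports Defs
begin

text \<open>Two sequences of equal length are within edit distance 1 iff deleting the letter at some common
  position makes them equal. Hence the pairs (position, sequence with that position
  deleted) are the optimal buckets. For the lower bounds, the sequences sharing a bucket are pairwise
  at Hamming distance at most 1, so they all lie on one line, which has \<open>|\<Sigma>|\<close> points. The \<open>n\<close>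
  neighbours of \<open>s\<close> obtained by changing different positions are pairwise at distance 2, so \<open>s\<close>
  shares different buckets with them and has at least \<open>n\<close> buckets. Double counting the pairs
  (sequence, bucket) gives \<open>n |\<Sigma>|^n \<le> |B'| |\<Sigma>|\<close>.\<close>

definition erase :: "nat \<Rightarrow> 'a list \<Rightarrow> 'a list" where
  "erase i s = take i s @ drop (Suc i) s"

lemma erase_eq_iff_update:
  assumes "length s = length t" "i < length s"
  shows "erase i s = erase i t \<longleftrightarrow> t = s[i := t ! i]"
proof -
  have "t = take i t @ t ! i # drop (Suc i) t"
    using assms by (simp add: id_take_nth_drop)
  then have "t = s[i := t ! i] \<longleftrightarrow>
      take i t @ t ! i # drop (Suc i) t = take i s @ t ! i # drop (Suc i) s"
    using assms by (metis upd_conv_take_nth_drop)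
  then show ?thesis
    using assms by (auto simp: erase_def)
qed

lemma erase_eq_iff_nth:
  assumes "length s = length t" "i < length s"
  shows "erase i s = erase i t \<longleftrightarrow> (\<forall>j < length s. j \<noteq> i \<longrightarrow> s ! j = t ! j)"
  unfolding erase_eq_iff_update[OF assms] using assms
  by (auto simp: list_eq_iff_nth_eq nth_list_update)

lemma erase_in_seqs:
  assumes "s \<in> seqs \<Sigma> n" "i < n"
  shows "erase i s \<in> seqs \<Sigma> (n - 1)"
  using assms by (auto simp: seqs_def erase_def dest: in_set_takeD in_set_dropD)

lemma finite_seqs: "finite \<Sigma> \<Longrightarrow> finite (seqs \<Sigma> n)"
  by (simp add: seqs_def finite_lists_length_eq)

lemma card_seqs: "finite \<Sigma> \<Longrightarrow> card (seqs \<Sigma> n) = card \<Sigma> ^ n"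
  by (simp add: seqs_def card_lists_length_eq)

lemma update_in_seqs: "s \<in> seqs \<Sigma> n \<Longrightarrow> a \<in> \<Sigma> \<Longrightarrow> s[i := a] \<in> seqs \<Sigma> n"
  using set_update_subset_insert[of s i a] by (auto simp: seqs_def)

lemma edit_steps_to_Nil: "set s \<subseteq> \<Sigma> \<Longrightarrow> (edit_step \<Sigma>)\<^sup>*\<^sup>* s []"
proof (induction s)
  case (Cons a s)
  then have "edit_step \<Sigma> (a # s) s"
    using edit_step.deletion[of "[]" s \<Sigma> a] by simp
  with Cons show ?case
    by (simp add: converse_rtranclp_into_rtranclp)
qed simp

lemma edit_steps_from_Nil: "set s \<subseteq> \<Sigma> \<Longrightarrow> (edit_step \<Sigma>)\<^sup>*\<^sup>* [] s"
proof (induction s)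
  case (Cons a s)
  then have "edit_step \<Sigma> s (a # s)"
    using edit_step.insertion[of "[]" s \<Sigma> a] by simp
  with Cons show ?case
    by (simp add: rtranclp.rtrancl_into_rtrancl)
qed simp

lemma edit_attained:
  assumes "set s \<subseteq> \<Sigma>" "set t \<subseteq> \<Sigma>"
  shows "(edit_step \<Sigma> ^^ edit \<Sigma> s t) s t"
proof -
  have "(edit_step \<Sigma>)\<^sup>*\<^sup>* s t"
    using edit_steps_to_Nil[OF assms(1)] edit_steps_from_Nil[OF assms(2)] by (rule rtranclp_trans)
  then obtain k where "(edit_step \<Sigma> ^^ k) s t"
    by (metis rtranclp_imp_relpowp)
  then show ?thesis
    unfolding edit_def by (rule LeastI)
qed

lemma edit_step_same_length:
  assumes "edit_step \<Sigma> s t" "length s = length t"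
  shows "\<exists>i < length s. erase i s = erase i t"
  using assms
proof cases
  case (substitution u v a b)
  then have "erase (length u) s = erase (length u) t" "length u < length s"
    by (simp_all add: erase_def)
  then show ?thesis by blast
qed (use assms in auto)

lemma edit_le_1_iff:
  assumes s: "s \<in> seqs \<Sigma> n" and t: "t \<in> seqs \<Sigma> n" and "n \<ge> 1"
  shows "edit \<Sigma> s t \<le> 1 \<longleftrightarrow> (\<exists>i < n. erase i s = erase i t)"
proof
  assume "edit \<Sigma> s t \<le> 1"
  then consider "edit \<Sigma> s t = 0" | "edit \<Sigma> s t = 1" by linarith
  moreover have "(edit_step \<Sigma> ^^ edit \<Sigma> s t) s t"
    using s t by (intro edit_attained) (auto simp: seqs_def)
  ultimately consider "s = t" | "edit_step \<Sigma> s t"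
    by cases (auto simp: relpowp_1)
  then show "\<exists>i < n. erase i s = erase i t"
  proof cases
    case 1
    with \<open>n \<ge> 1\<close> show ?thesis by (intro exI[of _ 0]) simp
  next
    case 2
    with s t show ?thesis
      using edit_step_same_length[of \<Sigma> s t] by (simp add: seqs_def)
  qed
next
  assume "\<exists>i < n. erase i s = erase i t"
  then obtain i where i: "i < n" "erase i s = erase i t" by blast
  define u v where "u = take i s" and "v = drop (Suc i) s"
  have len: "length s = n" "length t = n"
    using s t by (simp_all add: seqs_def)
  have s_eq: "s = u @ s ! i # v"
    using i len by (simp add: u_def v_def id_take_nth_drop)
  have "t = s[i := t ! i]"
    using i len erase_eq_iff_update[of s t i] by simp
  then have t_eq: "t = u @ t ! i # v"
    using i len by (metis u_def v_def upd_conv_take_nth_drop)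
  have sub: "set (u @ v) \<subseteq> \<Sigma>"
    using s by (auto simp: seqs_def u_def v_def dest: in_set_takeD in_set_dropD)
  have mem: "s ! i \<in> \<Sigma>" "t ! i \<in> \<Sigma>"
    using s t i by (auto simp: seqs_def)
  show "edit \<Sigma> s t \<le> 1"
  proof (cases "s ! i = t ! i")
    case True
    with s_eq t_eq have "(edit_step \<Sigma> ^^ 0) s t" by simp
    then have "edit \<Sigma> s t \<le> 0"
      unfolding edit_def by (rule Least_le)
    then show ?thesis by simp
  next
    case False
    then have "edit_step \<Sigma> s t"
      using edit_step.substitution[OF sub mem False] s_eq t_eq by simp
    then have "(edit_step \<Sigma> ^^ 1) s t" by (simp only: relpowp_1)
    then show ?thesis
      unfolding edit_def by (rule Least_le)
  qed
qed

lemma sensitive_1_2_iff: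
  assumes "n \<ge> 1"
  shows "sensitive \<Sigma> n 1 2 f \<longleftrightarrow>
    (\<forall>s \<in> seqs \<Sigma> n. \<forall>t \<in> seqs \<Sigma> n.
      f s \<inter> f t \<noteq> {} \<longleftrightarrow> (\<exists>i < n. erase i s = erase i t))"
proof -
  have "(edit \<Sigma> s t \<le> 1 \<longrightarrow> f s \<inter> f t \<noteq> {}) \<and> (edit \<Sigma> s t \<ge> 2 \<longrightarrow> f s \<inter> f t = {}) \<longleftrightarrow>
      (f s \<inter> f t \<noteq> {} \<longleftrightarrow> (\<exists>i < n. erase i s = erase i t))"
    if "s \<in> seqs \<Sigma> n" "t \<in> seqs \<Sigma> n" for s t
  proof -
    have "edit \<Sigma> s t \<ge> 2 \<longleftrightarrow> \<not> edit \<Sigma> s t \<le> 1" by linarith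
    then show ?thesis
      unfolding edit_le_1_iff[OF that assms, symmetric] by blast
  qed
  then show ?thesis
    unfolding sensitive_def by simp
qed

lemma ex_sensitive_bucketing:
  fixes \<Sigma> :: "'a set"
  assumes "finite \<Sigma>" "n \<ge> 1"
  shows "\<exists>f :: 'a list \<Rightarrow> nat set.
    bucketing_function \<Sigma> n {1..n * card \<Sigma> ^ (n - 1)} f \<and> sensitive \<Sigma> n 1 2 f \<and>
    (\<forall>s \<in> seqs \<Sigma> n. card (f s) = n)"
proof -
  let ?K = "{..<n} \<times> seqs \<Sigma> (n - 1)"
  have "finite ?K" "card ?K = card {1..n * card \<Sigma> ^ (n - 1)}"
    using assms by (simp_all add: finite_seqs card_seqs card_cartesian_product)
  then obtain h where h: "bij_betw h ?K {1..n * card \<Sigma> ^ (n - 1)}"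
    using finite_same_card_bij[of ?K "{1..n * card \<Sigma> ^ (n - 1)}"] by blast
  then have inj: "inj_on h ?K" by (simp add: bij_betw_def)
  define f where "f s = (\<lambda>i. h (i, erase i s)) ` {..<n}" for s
  have key: "(i, erase i s) \<in> ?K" if "s \<in> seqs \<Sigma> n" "i < n" for s i
    using erase_in_seqs[OF that] that by simp
  have eq_iff: "h (i, erase i s) = h (j, erase j t) \<longleftrightarrow> i = j \<and> erase i s = erase j t"
    if "s \<in> seqs \<Sigma> n" "t \<in> seqs \<Sigma> n" "i < n" "j < n" for s t i j
    using inj_on_eq_iff[OF inj key[OF that(1,3)] key[OF that(2,4)]] by simp
  have "bucketing_function \<Sigma> n {1..n * card \<Sigma> ^ (n - 1)} f"
    unfolding bucketing_function_def
  proof (intro ballI PowI subsetI)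
    fix s b assume "s \<in> seqs \<Sigma> n" "b \<in> f s"
    then show "b \<in> {1..n * card \<Sigma> ^ (n - 1)}"
      using bij_betwE[OF h] key by (force simp: f_def)
  qed
  moreover have "sensitive \<Sigma> n 1 2 f"
    unfolding sensitive_1_2_iff[OF assms(2)]
  proof (intro ballI)
    fix s t assume "s \<in> seqs \<Sigma> n" "t \<in> seqs \<Sigma> n"
    then show "f s \<inter> f t \<noteq> {} \<longleftrightarrow> (\<exists>i < n. erase i s = erase i t)"
      using eq_iff[of s t] unfolding f_def disjoint_iff by (auto simp: image_iff)
  qed
  moreover have "card (f s) = n" if "s \<in> seqs \<Sigma> n" for s
  proof -
    have "inj_on (\<lambda>i. h (i, erase i s)) {..<n}"
      using eq_iff[OF that that] by (auto simp: inj_on_def)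
    then show ?thesis by (simp add: f_def card_image)
  qed
  ultimately show ?thesis by blast
qed

lemma sensitive_card_ge:
  assumes "n \<ge> 1" "card \<Sigma> > 1" "sensitive \<Sigma> n 1 2 g" and s: "s \<in> seqs \<Sigma> n"
    and "finite (g s)"
  shows "n \<le> card (g s)"
proof -
  have sens: "g u \<inter> g t \<noteq> {} \<longleftrightarrow> (\<exists>i < n. erase i u = erase i t)"
    if "u \<in> seqs \<Sigma> n" "t \<in> seqs \<Sigma> n" for u t
    using assms(3) that unfolding sensitive_1_2_iff[OF assms(1)] by blast
  have len: "length s = n" using s by (simp add: seqs_def)
  have "\<exists>a \<in> \<Sigma>. a \<noteq> c" for c
    using \<open>card \<Sigma> > 1\<close> by (metis One_nat_def card_le_Suc0_iff_eq card.infinite not_le zero_le)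
  then obtain other where other: "other c \<in> \<Sigma>" "other c \<noteq> c" for c by metis
  define nb where "nb i = s[i := other (s ! i)]" for i
  have nb: "nb i \<in> seqs \<Sigma> n" for i
    using s other by (simp add: nb_def update_in_seqs)
  have "\<exists>b. b \<in> g s \<inter> g (nb i)" if "i < n" for i
  proof -
    have "erase i s = erase i (nb i)"
      using that len by (simp add: erase_def nb_def)
    with that show ?thesis using sens[OF s nb] by blast
  qed
  then obtain b where b: "i < n \<Longrightarrow> b i \<in> g s \<inter> g (nb i)" for i by metis
  have "inj_on b {..<n}"
  proof (rule inj_onI, rule ccontr)
    fix i j assume ij: "i \<in> {..<n}" "j \<in> {..<n}" "b i = b j" "i \<noteq> j"
    then have "g (nb i) \<inter> g (nb j) \<noteq> {}" using b by fastforce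
    then obtain k where "k < n" "erase k (nb i) = erase k (nb j)"
      using sens[OF nb nb] by blast
    then have "\<forall>l < n. l \<noteq> k \<longrightarrow> nb i ! l = nb j ! l"
      using len erase_eq_iff_nth[of "nb i" "nb j" k] by (simp add: nb_def)
    moreover have "nb i ! i \<noteq> nb j ! i" "nb i ! j \<noteq> nb j ! j"
      using ij len other by (auto simp: nb_def) (metis other(2))
    ultimately show False using ij by blast
  qed
  then have "card (b ` {..<n}) = n" by (simp add: card_image)
  moreover have "b ` {..<n} \<subseteq> g s" using b by auto
  ultimately show ?thesis
    using \<open>finite (g s)\<close> by (metis card_mono)
qed

lemma card_pairwise_erase_eq_le:
  assumes "finite \<Sigma>" "\<Sigma> \<noteq> {}" and C: "C \<subseteq> seqs \<Sigma> n"
    and close: "\<And>s t. s \<in> C \<Longrightarrow> t \<in> C \<Longrightarrow> \<exists>i < n. erase i s = erase i t"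
  shows "card C \<le> card \<Sigma>"
proof (cases "\<exists>s \<in> C. \<exists>t \<in> C. s \<noteq> t")
  case False
  have "finite C" using C assms(1) finite_seqs finite_subset by blast
  with False have "card C \<le> 1" by (auto simp: card_le_Suc0_iff_eq)
  also have "1 \<le> card \<Sigma>" using assms(1,2) by (simp add: Suc_le_eq card_gt_0_iff)
  finally show ?thesis .
next
  case True
  have len: "length s = n" if "s \<in> C" for s using that C by (auto simp: seqs_def)
  have close': "\<exists>i < n. \<forall>j < n. j \<noteq> i \<longrightarrow> s ! j = t ! j" if "s \<in> C" "t \<in> C" for s t
    using close[OF that] erase_eq_iff_nth[of s t] len that by metis
  from True obtain s t where st: "s \<in> C" "t \<in> C" "s \<noteq> t" by blast
  then obtain i where i: "i < n" "\<forall>j < n. j \<noteq> i \<longrightarrow> s ! j = t ! j"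
    using close' by blast
  with st len have ne: "s ! i \<noteq> t ! i"
    by (metis nth_equalityI)
  have line: "u ! j = s ! j" if "u \<in> C" "j < n" "j \<noteq> i" for u j
  proof (rule ccontr)
    assume "u ! j \<noteq> s ! j"
    moreover obtain k where "\<forall>l < n. l \<noteq> k \<longrightarrow> u ! l = s ! l"
      using close'[OF \<open>u \<in> C\<close> st(1)] by blast
    moreover obtain k' where "\<forall>l < n. l \<noteq> k' \<longrightarrow> u ! l = t ! l"
      using close'[OF \<open>u \<in> C\<close> st(2)] by blast
    ultimately show False using that i ne by metis
  qed
  have "inj_on (\<lambda>u. u ! i) C"
  proof (rule inj_onI)
    fix u v assume uv: "u \<in> C" "v \<in> C" "u ! i = v ! i"
    show "u = v"
      by (rule nth_equalityI) (use uv len line in metis)+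
  qed
  moreover have "(\<lambda>u. u ! i) ` C \<subseteq> \<Sigma>"
    using C i by (fastforce simp: seqs_def)
  ultimately show ?thesis
    using assms(1) by (metis card_inj_on_le)
qed

lemma sensitive_card_buckets_ge:
  assumes "finite \<Sigma>" "card \<Sigma> > 1" "n \<ge> 1" "finite B"
    and bucketing: "bucketing_function \<Sigma> n B g" and sens: "sensitive \<Sigma> n 1 2 g"
  shows "n * card \<Sigma> ^ (n - 1) \<le> card B"
proof -
  let ?S = "seqs \<Sigma> n"
  have sub: "g s \<subseteq> B" if "s \<in> ?S" for s
    using bucketing that by (auto simp: bucketing_function_def)
  have fin: "finite (g s)" if "s \<in> ?S" for s
    using sub[OF that] \<open>finite B\<close> by (rule finite_subset)
  have "card {s \<in> ?S. b \<in> g s} \<le> card \<Sigma>" for b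
  proof (rule card_pairwise_erase_eq_le[where n = n])
    show "\<Sigma> \<noteq> {}" using assms(2) by auto
    fix s t assume "s \<in> {s \<in> ?S. b \<in> g s}" "t \<in> {s \<in> ?S. b \<in> g s}"
    then have "s \<in> ?S" "t \<in> ?S" "g s \<inter> g t \<noteq> {}" by auto
    with sens show "\<exists>i < n. erase i s = erase i t"
      unfolding sensitive_1_2_iff[OF assms(3)] by blast
  qed (use assms(1) in auto)
  note line = this
  have "n * card \<Sigma> ^ (n - 1) * card \<Sigma> = (\<Sum>s\<in>?S. n)"
    using assms(1,3) by (simp add: card_seqs power_eq_if)
  also have "\<dots> \<le> (\<Sum>s\<in>?S. card (g s))"
    using sensitive_card_ge[OF assms(3,2) sens] fin by (intro sum_mono) blast
  also have "\<dots> = (\<Sum>s\<in>?S. card {b \<in> B. b \<in> g s})"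
    using sub by (intro sum.cong refl arg_cong[where f = card]) auto
  also have "\<dots> = (\<Sum>b\<in>B. card {s \<in> ?S. b \<in> g s})"
    using assms(1,4) by (intro sum_multicount_gen) (simp_all add: finite_seqs)
  also have "\<dots> \<le> card B * card \<Sigma>"
    using sum_bounded_above[of B "\<lambda>b. card {s \<in> ?S. b \<in> g s}" "card \<Sigma>"] line by simp
  finally show ?thesis
    using assms(2) by simp
qed

theorem theorem1:
  fixes \<Sigma> :: "'a set" and n :: nat
  assumes "finite \<Sigma>" and "card \<Sigma> > 1" and "n \<ge> 1"
  shows "(\<exists>f :: 'a list \<Rightarrow> nat set.
            bucketing_function \<Sigma> n {1..n * card \<Sigma> ^ (n - 1)} f \<and>
            sensitive \<Sigma> n 1 2 f \<and>
            (\<forall>s \<in> seqs \<Sigma> n. card (f s) = n)) \<and>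
         (\<forall>B' :: 'b set. finite B' \<longrightarrow>
            (card B' < n * card \<Sigma> ^ (n - 1) \<longrightarrow>
              \<not> (\<exists>g. bucketing_function \<Sigma> n B' g \<and> sensitive \<Sigma> n 1 2 g)) \<and>
            \<not> (\<exists>g. bucketing_function \<Sigma> n B' g \<and> sensitive \<Sigma> n 1 2 g \<and>
                  (\<exists>s \<in> seqs \<Sigma> n. card (g s) < n)))"
proof (intro conjI allI impI notI)
  show "\<exists>f :: 'a list \<Rightarrow> nat set.
      bucketing_function \<Sigma> n {1..n * card \<Sigma> ^ (n - 1)} f \<and> sensitive \<Sigma> n 1 2 f \<and>
      (\<forall>s \<in> seqs \<Sigma> n. card (f s) = n)"
    using assms(1,3) by (rule ex_sensitive_bucketing)
next
  fix B' :: "'b set"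
  assume "finite B'" "card B' < n * card \<Sigma> ^ (n - 1)"
    "\<exists>g. bucketing_function \<Sigma> n B' g \<and> sensitive \<Sigma> n 1 2 g"
  then show False
    using sensitive_card_buckets_ge[OF assms] by (meson not_le)
next
  fix B' :: "'b set"
  assume "finite B'" "\<exists>g. bucketing_function \<Sigma> n B' g \<and> sensitive \<Sigma> n 1 2 g \<and>
    (\<exists>s \<in> seqs \<Sigma> n. card (g s) < n)"
  then obtain g s where g: "bucketing_function \<Sigma> n B' g" "sensitive \<Sigma> n 1 2 g"
    and s: "s \<in> seqs \<Sigma> n" "card (g s) < n" by blast
  then have "finite (g s)"
    using \<open>finite B'\<close> by (auto simp: bucketing_function_def intro: finite_subset)
  with sensitive_card_ge[OF assms(3,2) g(2) s(1)] s(2) show False by simp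
qed

end
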